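(* Let $p$ be a prime, $K$ an F-finite field of characteristic $p$, and $I$ a proper monomial ideal, generated by finitely many (at least one) monomials, in $S=K[x_1,\dots,x_m]$. Then every critical exponent of $I$ is a rational number.
   Context: $K$ is F-finite if it is finitely generated over $K^p$. $q$ always denotes a power $p^e$, $e\ge 0$. For an ideal $J\subseteq S$, $J^{[q]}=(f^q\mid f\in J)$ and $J^{[1/q]}$ is the smallest ideal $L$ with $L^{[q]}\supseteq J$. For an integer $k\ge 0$ with base $p$ expansion $k=k_0+k_1p+\cdots+k_rp^r$, $I^{[k]}=I^{k_0}(I^{k_1})^{[p]}\cdots(I^{k_r})^{[p^r]}$. Put $I^{[k/q]}=(I^{[k]})^{[1/q]}$. For real $\lambda\ge 0$, $I^{[\lambda]}$ is the stable value of the ascending chain $I^{[\lambda_1]}\subseteq I^{[\lambda_2]}\subseteq\cdots$ for any monotone decreasing sequence $(\lambda_j)$ of rationals of the form $k/q$ converging to $\lambda$ from above. A critical exponent of $I$ is a real number $\lambda>0$ such that $I^{[\mu]}\ne I^{[\lambda]}$ for all $0\le\mu<\lambda$. *)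

theory Defs
  imports
    Complex_Main
    "HOL-Computational_Algebra.Primes"
    "HOL-Library.Poly_Mapping"
begin

text \<open>
  The polynomial ring \<open>K[x\<^sub>1,\<dots>,x\<^sub>m]\<close> is the monoid algebra \<open>('n \<Rightarrow>\<^sub>0 nat) \<Rightarrow>\<^sub>0 'k\<close>, where the
  finite type \<open>'n\<close> indexes the variables (so \<open>m = CARD('n)\<close>) and \<open>'n \<Rightarrow>\<^sub>0 nat\<close> is the monoid of
  exponent vectors.
\<close>

type_synonym ('n, 'k) mpoly = "('n \<Rightarrow>\<^sub>0 nat) \<Rightarrow>\<^sub>0 'k"

definition monomial :: "('n \<Rightarrow>\<^sub>0 nat) \<Rightarrow> ('n, 'k::field) mpoly" where
  "monomial a = Poly_Mapping.single a 1"

text \<open>Ideals of a commutative ring are its submodules, the ring being a module over itself.\<close>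

lemma module_times: "module ((*) :: 'a::comm_ring_1 \<Rightarrow> 'a \<Rightarrow> 'a)"
  by unfold_locales (simp_all add: algebra_simps)

abbreviation is_ideal :: "'a::comm_ring_1 set \<Rightarrow> bool" where
  "is_ideal \<equiv> module.subspace (*)"

abbreviation ideal_gen :: "'a::comm_ring_1 set \<Rightarrow> 'a set" where
  "ideal_gen \<equiv> module.span (*)"

definition ideal_mult :: "'a::comm_ring_1 set \<Rightarrow> 'a set \<Rightarrow> 'a set" where
  "ideal_mult I J = ideal_gen {f * g | f g. f \<in> I \<and> g \<in> J}"

primrec ideal_pow :: "'a::comm_ring_1 set \<Rightarrow> nat \<Rightarrow> 'a set" where
  "ideal_pow I 0 = UNIV"
| "ideal_pow I (Suc n) = ideal_mult I (ideal_pow I n)"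

definition F_finite :: "nat \<Rightarrow> 'k::field itself \<Rightarrow> bool" where
  "F_finite p _ \<longleftrightarrow>
     (\<exists>B::'k set. finite B \<and>
        (\<forall>x. \<exists>c. (\<forall>b\<in>B. c b \<in> {y ^ p | y. True}) \<and> x = (\<Sum>b\<in>B. c b * b)))"

text \<open>\<open>J\<^bsup>[q]\<^esup>\<close> and \<open>J\<^bsup>[1/q]\<^esup>\<close>\<close>

definition bracket_pow :: "nat \<Rightarrow> 'a::comm_ring_1 set \<Rightarrow> 'a set" where
  "bracket_pow q J = ideal_gen {f ^ q | f. f \<in> J}"

definition bracket_root :: "nat \<Rightarrow> 'a::comm_ring_1 set \<Rightarrow> 'a set" where
  "bracket_root q J = (LEAST L. is_ideal L \<and> J \<subseteq> bracket_pow q L)"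

text \<open>
  \<open>I\<^bsup>[k]\<^esup>\<close>: the \<open>i\<close>-th base \<open>p\<close> digit of \<open>k\<close> is \<open>k div p ^ i mod p\<close>. For \<open>p \<ge> 2\<close> all digits with
  \<open>i > k\<close> vanish; vanishing digits contribute the unit ideal to the product.
\<close>

definition frob_pow_nat :: "nat \<Rightarrow> 'a::comm_ring_1 set \<Rightarrow> nat \<Rightarrow> 'a set" where
  "frob_pow_nat p I k =
     foldr ideal_mult
       (map (\<lambda>i. bracket_pow (p ^ i) (ideal_pow I (k div p ^ i mod p))) [0..<Suc k]) UNIV"

text \<open>\<open>I\<^bsup>[k/q]\<^esup>\<close> for \<open>q = p ^ e\<close>\<close>

definition frob_pow_frac :: "nat \<Rightarrow> 'a::comm_ring_1 set \<Rightarrow> nat \<Rightarrow> nat \<Rightarrow> 'a set" where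
  "frob_pow_frac p I k e = bracket_root (p ^ e) (frob_pow_nat p I k)"

text \<open>
  \<open>I\<^bsup>[\<lambda>]\<^esup>\<close>: the ideal at which \<open>I\<^bsup>[k j / p ^ e j]\<^esup>\<close> stabilises, for every (weakly) decreasing sequence
  \<open>k j / p ^ e j\<close> converging to \<open>\<lambda>\<close>.
\<close>

definition frob_pow :: "nat \<Rightarrow> 'a::comm_ring_1 set \<Rightarrow> real \<Rightarrow> 'a set" where
  "frob_pow p I l =
     (THE J. \<forall>k e :: nat \<Rightarrow> nat.
        decseq (\<lambda>j. real (k j) / real (p ^ e j)) \<longrightarrow>
        (\<lambda>j. real (k j) / real (p ^ e j)) \<longlonglongrightarrow> l \<longrightarrow>
        (\<forall>\<^sub>F j in sequentially. frob_pow_frac p I (k j) (e j) = J))"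

definition critical_exponent :: "nat \<Rightarrow> 'a::comm_ring_1 set \<Rightarrow> real \<Rightarrow> bool" where
  "critical_exponent p I l \<longleftrightarrow>
     l > 0 \<and> (\<forall>\<mu>. 0 \<le> \<mu> \<and> \<mu> < l \<longrightarrow> frob_pow p I \<mu> \<noteq> frob_pow p I l)"

end

theory Submission
  imports Defs "HOL-Library.FuncSet"
begin

text \<open>
  All ideals involved are monomial, so they are encoded by up-closed sets of exponent vectors.
  Three facts about \<open>I\<^bsup>[\<lambda>]\<^esup>\<close> suffice. First, \<open>I\<^bsup>[\<lambda>]\<^esup> = (I\<^bsup>[p\<lambda>]\<^esup>)\<^bsup>[1/p]\<^esup>\<close>, so that \<open>p\<lambda>\<close> is a critical
  exponent whenever \<open>\<lambda>\<close> is. Second, \<open>I\<^bsup>[n+\<lambda>]\<^esup> = I\<^bsup>[n]\<^esup> I\<^bsup>[\<lambda>]\<^esup>\<close> for \<open>0 \<le> \<lambda> < 1\<close>, so that the fractional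
  part of a critical exponent is critical or zero. Third, for \<open>\<lambda> \<le> 1\<close> the ideal \<open>I\<^bsup>[\<lambda>]\<^esup>\<close> is
  generated by monomials in a fixed box, so there are only finitely many critical exponents in
  \<open>(0,1)\<close>. Hence two of the numbers \<open>p\<^sup>e \<lambda>\<close> have the same fractional part, and \<open>\<lambda>\<close> is rational.
\<close>

section \<open>Up-closed sets of exponent vectors\<close>

definition up_closed :: "('n \<Rightarrow> nat) set \<Rightarrow> bool" where
  "up_closed X \<longleftrightarrow> (\<forall>x\<in>X. \<forall>y. x \<le> y \<longrightarrow> y \<in> X)"

text \<open>Exponent set of a product of two monomial ideals. The inequality, in place of an
  equality, closes the set upwards whatever \<open>X\<close> and \<open>Y\<close> are.\<close>

definition up_add :: "('n \<Rightarrow> nat) set \<Rightarrow> ('n \<Rightarrow> nat) set \<Rightarrow> ('n \<Rightarrow> nat) set" where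
  "up_add X Y = {w. \<exists>x\<in>X. \<exists>y\<in>Y. \<forall>i. x i + y i \<le> w i}"

definition up_scale :: "nat \<Rightarrow> ('n \<Rightarrow> nat) set \<Rightarrow> ('n \<Rightarrow> nat) set" where
  "up_scale q X = {w. \<exists>x\<in>X. \<forall>i. q * x i \<le> w i}"

text \<open>Exponent set of \<open>J^[1/q]\<close>. For \<open>q > 0\<close>,
  \<open>q * y i \<le> x i\<close> holds exactly when \<open>y i \<le> x i div q\<close>, so a
  monomial ideal \<open>L\<close> has the monomial with exponent \<open>x\<close> in
  \<open>L^[q]\<close> iff it contains the one with exponent \<open>x div q\<close>.\<close>

definition up_div :: "nat \<Rightarrow> ('n \<Rightarrow> nat) set \<Rightarrow> ('n \<Rightarrow> nat) set" where
  "up_div q X = {w. \<exists>x\<in>X. \<forall>i. x i div q \<le> w i}"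

primrec up_pow :: "('n \<Rightarrow> nat) set \<Rightarrow> nat \<Rightarrow> ('n \<Rightarrow> nat) set" where
  "up_pow X 0 = UNIV"
| "up_pow X (Suc n) = up_add X (up_pow X n)"

lemma up_closedD: "up_closed X \<Longrightarrow> x \<in> X \<Longrightarrow> (\<And>i. x i \<le> y i) \<Longrightarrow> y \<in> X"
  by (auto simp: up_closed_def le_fun_def)

lemma up_closed_UNIV [simp]: "up_closed UNIV"
  by (simp add: up_closed_def)

lemma up_closed_up_add [simp]: "up_closed (up_add X Y)"
  unfolding up_closed_def up_add_def le_fun_def by (blast intro: order_trans)

lemma up_closed_up_scale [simp]: "up_closed (up_scale q X)"
  by (auto simp: up_closed_def up_scale_def le_fun_def intro: order_trans)

lemma up_closed_up_div [simp]: "up_closed (up_div q X)"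
  by (auto simp: up_closed_def up_div_def le_fun_def intro: order_trans)

lemma up_closed_up_pow [simp]: "up_closed (up_pow X n)"
  by (cases n) auto

lemma up_addI: "x \<in> X \<Longrightarrow> y \<in> Y \<Longrightarrow> (\<And>i. x i + y i \<le> w i) \<Longrightarrow> w \<in> up_add X Y"
  by (auto simp: up_add_def)

lemma up_addE:
  assumes "w \<in> up_add X Y"
  obtains x y where "x \<in> X" "y \<in> Y" "\<And>i. x i + y i \<le> w i"
  using assms by (auto simp: up_add_def)

lemma up_scaleI: "x \<in> X \<Longrightarrow> (\<And>i. q * x i \<le> w i) \<Longrightarrow> w \<in> up_scale q X"
  by (auto simp: up_scale_def)

lemma up_scaleE:
  assumes "w \<in> up_scale q X"
  obtains x where "x \<in> X" "\<And>i. q * x i \<le> w i"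
  using assms by (auto simp: up_scale_def)

lemma up_divI: "x \<in> X \<Longrightarrow> (\<And>i. x i div q \<le> w i) \<Longrightarrow> w \<in> up_div q X"
  by (auto simp: up_div_def)

lemma up_divE:
  assumes "w \<in> up_div q X"
  obtains x where "x \<in> X" "\<And>i. x i div q \<le> w i"
  using assms by (auto simp: up_div_def)

lemma up_add_commute: "up_add X Y = up_add Y X"
  by (auto elim!: up_addE intro: up_addI simp: add.commute)

lemma up_add_assoc: "up_add (up_add X Y) Z = up_add X (up_add Y Z)"
proof -
  have "(w \<in> up_add (up_add X Y) Z) = (\<exists>x\<in>X. \<exists>y\<in>Y. \<exists>z\<in>Z. \<forall>i. x i + y i + z i \<le> w i)" for w
  proof
    assume "w \<in> up_add (up_add X Y) Z"
    then obtain v z where v: "v \<in> up_add X Y" and z: "z \<in> Z" "\<And>i. v i + z i \<le> w i"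
      by (rule up_addE) blast
    from v obtain x y where xy: "x \<in> X" "y \<in> Y" "\<And>i. x i + y i \<le> v i"
      by (rule up_addE) blast
    have "x i + y i + z i \<le> w i" for i
      using z(2)[of i] xy(3)[of i] by linarith
    with xy z show "\<exists>x\<in>X. \<exists>y\<in>Y. \<exists>z\<in>Z. \<forall>i. x i + y i + z i \<le> w i" by blast
  next
    assume "\<exists>x\<in>X. \<exists>y\<in>Y. \<exists>z\<in>Z. \<forall>i. x i + y i + z i \<le> w i"
    then obtain x y z where *: "x \<in> X" "y \<in> Y" "z \<in> Z" "\<And>i. x i + y i + z i \<le> w i" by blast
    show "w \<in> up_add (up_add X Y) Z"
      by (rule up_addI[of "\<lambda>i. x i + y i"]) (use * in \<open>auto intro: up_addI\<close>)
  qed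
  moreover have "(w \<in> up_add X (up_add Y Z)) = (\<exists>x\<in>X. \<exists>y\<in>Y. \<exists>z\<in>Z. \<forall>i. x i + y i + z i \<le> w i)" for w
  proof
    assume "w \<in> up_add X (up_add Y Z)"
    then obtain v x where v: "v \<in> up_add Y Z" and z: "x \<in> X" "\<And>i. x i + v i \<le> w i"
      by (rule up_addE) blast
    from v obtain y z where xy: "y \<in> Y" "z \<in> Z" "\<And>i. y i + z i \<le> v i"
      by (rule up_addE) blast
    have "x i + y i + z i \<le> w i" for i
      using z(2)[of i] xy(3)[of i] by linarith
    with xy z show "\<exists>x\<in>X. \<exists>y\<in>Y. \<exists>z\<in>Z. \<forall>i. x i + y i + z i \<le> w i" by blast
  next
    assume "\<exists>x\<in>X. \<exists>y\<in>Y. \<exists>z\<in>Z. \<forall>i. x i + y i + z i \<le> w i"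
    then obtain x y z where *: "x \<in> X" "y \<in> Y" "z \<in> Z" "\<And>i. x i + y i + z i \<le> w i" by blast
    show "w \<in> up_add X (up_add Y Z)"
      by (rule up_addI[of x _ "\<lambda>i. y i + z i"]) (use * in \<open>auto intro: up_addI simp: add.assoc\<close>)
  qed
  ultimately show ?thesis by auto
qed

lemma up_add_left_commute: "up_add X (up_add Y Z) = up_add Y (up_add X Z)"
  by (metis up_add_assoc up_add_commute)

lemma up_add_subset: "up_closed Y \<Longrightarrow> up_add X Y \<subseteq> Y"
  by (auto elim!: up_addE intro: up_closedD order_trans[OF le_add2])

lemma up_add_mono: "X \<subseteq> X' \<Longrightarrow> Y \<subseteq> Y' \<Longrightarrow> up_add X Y \<subseteq> up_add X' Y'"
  by (auto simp: up_add_def)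

lemma up_add_UNIV [simp]: "up_closed X \<Longrightarrow> up_add UNIV X = X" "up_closed X \<Longrightarrow> up_add X UNIV = X"
proof -
  assume X: "up_closed X"
  have "w \<in> up_add UNIV X" if "w \<in> X" for w
    by (rule up_addI[of "\<lambda>_. 0"]) (use that in auto)
  with up_add_subset[OF X] show "up_add UNIV X = X" by blast
  then show "up_add X UNIV = X" by (simp add: up_add_commute)
qed

lemma up_scale_mono: "X \<subseteq> Y \<Longrightarrow> up_scale q X \<subseteq> up_scale q Y"
  by (auto simp: up_scale_def)

lemma up_div_mono: "X \<subseteq> Y \<Longrightarrow> up_div q X \<subseteq> up_div q Y"
  by (auto simp: up_div_def)

lemma up_scale_UNIV [simp]: "up_scale q UNIV = UNIV"
  by (auto simp: up_scale_def intro: exI[of _ "\<lambda>_. 0"])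

lemma up_scale_1 [simp]: "up_closed X \<Longrightarrow> up_scale (Suc 0) X = X"
  by (auto simp: up_scale_def intro: up_closedD)

lemma up_div_1 [simp]: "up_closed X \<Longrightarrow> up_div (Suc 0) X = X"
  by (auto simp: up_div_def intro: up_closedD)

lemma up_div_UNIV [simp]: "up_div q UNIV = UNIV"
  by (auto simp: up_div_def intro: exI[of _ "\<lambda>_. 0"])

lemma up_scale_up_scale: "up_scale q (up_scale r X) = up_scale (q * r) X"
proof (intro equalityI subsetI)
  fix w assume "w \<in> up_scale q (up_scale r X)"
  then obtain v where v: "v \<in> up_scale r X" "\<And>i. q * v i \<le> w i" by (rule up_scaleE) blast
  from v(1) obtain x where x: "x \<in> X" "\<And>i. r * x i \<le> v i" by (rule up_scaleE) blast
  have "q * r * x i \<le> w i" for i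
    using order_trans[OF mult_le_mono2[OF x(2)] v(2)] by (simp add: mult.assoc)
  with x(1) show "w \<in> up_scale (q * r) X" by (auto intro: up_scaleI)
next
  fix w assume "w \<in> up_scale (q * r) X"
  then obtain x where x: "x \<in> X" "\<And>i. q * r * x i \<le> w i" by (rule up_scaleE) blast
  show "w \<in> up_scale q (up_scale r X)"
    by (rule up_scaleI[of "\<lambda>i. r * x i"]) (use x in \<open>auto intro: up_scaleI simp: mult.assoc\<close>)
qed

lemma up_scale_up_add: "up_scale q (up_add X Y) = up_add (up_scale q X) (up_scale q Y)"
proof (intro equalityI subsetI)
  fix w assume "w \<in> up_scale q (up_add X Y)"
  then obtain v where v: "v \<in> up_add X Y" "\<And>i. q * v i \<le> w i" by (rule up_scaleE) blast
  from v(1) obtain x y where x: "x \<in> X" "y \<in> Y" "\<And>i. x i + y i \<le> v i" by (rule up_addE) blast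
  have "q * x i + q * y i \<le> w i" for i
    using order_trans[OF mult_le_mono2[OF x(3)] v(2)] by (simp add: algebra_simps)
  with x show "w \<in> up_add (up_scale q X) (up_scale q Y)"
    by (intro up_addI[of "\<lambda>i. q * x i" _ "\<lambda>i. q * y i"]) (auto intro: up_scaleI)
next
  fix w assume "w \<in> up_add (up_scale q X) (up_scale q Y)"
  then obtain u v where v: "u \<in> up_scale q X" "v \<in> up_scale q Y" "\<And>i. u i + v i \<le> w i"
    by (rule up_addE) blast
  from v(1) obtain x where x: "x \<in> X" "\<And>i. q * x i \<le> u i" by (rule up_scaleE) blast
  from v(2) obtain y where y: "y \<in> Y" "\<And>i. q * y i \<le> v i" by (rule up_scaleE) blast
  have "q * (x i + y i) \<le> w i" for i
    using x(2)[of i] y(2)[of i] v(3)[of i] by (simp add: algebra_simps)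
  with x y show "w \<in> up_scale q (up_add X Y)"
    by (intro up_scaleI[of "\<lambda>i. x i + y i"]) (auto intro: up_addI)
qed

lemma up_div_up_div: "up_div q (up_div r X) = up_div (r * q) X"
proof (intro equalityI subsetI)
  fix w assume "w \<in> up_div q (up_div r X)"
  then obtain v where v: "v \<in> up_div r X" "\<And>i. v i div q \<le> w i" by (rule up_divE) blast
  from v(1) obtain x where x: "x \<in> X" "\<And>i. x i div r \<le> v i" by (rule up_divE) blast
  have "x i div (r * q) \<le> w i" for i
    using order_trans[OF div_le_mono[OF x(2)] v(2)] by (simp add: div_mult2_eq)
  with x(1) show "w \<in> up_div (r * q) X" by (auto intro: up_divI)
next
  fix w assume "w \<in> up_div (r * q) X"
  then obtain x where x: "x \<in> X" "\<And>i. x i div (r * q) \<le> w i" by (rule up_divE) blast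
  show "w \<in> up_div q (up_div r X)"
    by (rule up_divI[of "\<lambda>i. x i div r"]) (use x in \<open>auto intro: up_divI simp: div_mult2_eq\<close>)
qed

text \<open>Projection formula \<open>(J^[q] M)^[1/q] = J M^[1/q]\<close>. On exponents it is
  \<open>(q * x + y) div q = x + y div q\<close>.\<close>

lemma up_div_up_add_up_scale:
  assumes "q > 0"
  shows "up_div q (up_add (up_scale q X) Y) = up_add X (up_div q Y)"
proof (intro equalityI subsetI)
  fix w assume "w \<in> up_div q (up_add (up_scale q X) Y)"
  then obtain v where v: "v \<in> up_add (up_scale q X) Y" "\<And>i. v i div q \<le> w i"
    by (rule up_divE) blast
  from v(1) obtain u y where u: "u \<in> up_scale q X" "y \<in> Y" "\<And>i. u i + y i \<le> v i"
    by (rule up_addE) blast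
  from u(1) obtain x where x: "x \<in> X" "\<And>i. q * x i \<le> u i" by (rule up_scaleE) blast
  have "x i + y i div q \<le> w i" for i
  proof -
    have "x i + y i div q = (y i + q * x i) div q" using assms by simp
    also have "\<dots> \<le> v i div q" using x(2)[of i] u(3)[of i] by (intro div_le_mono) linarith
    finally show ?thesis using v(2)[of i] by linarith
  qed
  with x u show "w \<in> up_add X (up_div q Y)"
    by (intro up_addI[of x _ "\<lambda>i. y i div q"]) (auto intro: up_divI)
next
  fix w assume "w \<in> up_add X (up_div q Y)"
  then obtain x v where v: "x \<in> X" "v \<in> up_div q Y" "\<And>i. x i + v i \<le> w i" by (rule up_addE) blast
  from v(2) obtain y where y: "y \<in> Y" "\<And>i. y i div q \<le> v i" by (rule up_divE) blast
  show "w \<in> up_div q (up_add (up_scale q X) Y)"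
  proof (rule up_divI)
    show "(\<lambda>i. q * x i + y i) \<in> up_add (up_scale q X) Y"
      by (rule up_addI[of "\<lambda>i. q * x i" _ y]) (use v y in \<open>auto intro: up_scaleI\<close>)
    show "(q * x i + y i) div q \<le> w i" for i
      using assms y(2)[of i] v(3)[of i] by simp
  qed
qed

text \<open>The vector \<open>n * x\<close> is a sum of \<open>n\<close> copies of \<open>x\<close>.
  The case \<open>n = p\<close> gives \<open>J^[p] \<subseteq> J^p\<close>, which pays for a carry
  in base \<open>p\<close>.\<close>

lemma up_scale_subset_up_pow:
  assumes "up_closed X"
  shows "up_scale n X \<subseteq> up_pow X n"
proof (induction n)
  case (Suc n)
  show ?case
  proof
    fix w assume "w \<in> up_scale (Suc n) X"
    then obtain x where x: "x \<in> X" "\<And>i. Suc n * x i \<le> w i" by (rule up_scaleE) blast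
    have "(\<lambda>i. n * x i) \<in> up_pow X n"
      using Suc x(1) by (auto intro: up_scaleI)
    with x show "w \<in> up_pow X (Suc n)" by (auto intro!: up_addI[of x _ "\<lambda>i. n * x i"])
  qed
qed auto

text \<open>Horner form of the product over base \<open>p\<close> digits: \<open>I^[k]\<close> is
  \<open>I^(k mod p)\<close> times the \<open>p\<close>-th bracket power of
  \<open>I^[k div p]\<close>. The guard on \<open>p\<close> gives a default value where base
  \<open>p\<close> expansions make no sense, so the recursion always goes to a smaller
  argument.\<close>

function frob_set :: "nat \<Rightarrow> ('n \<Rightarrow> nat) set \<Rightarrow> nat \<Rightarrow> ('n \<Rightarrow> nat) set" where
  "frob_set p U k = (if k = 0 \<or> p < 2 then UNIV
     else up_add (up_pow U (k mod p)) (up_scale p (frob_set p U (k div p))))"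
  by auto
termination by (relation "measure (\<lambda>(p, U, k). k)") auto

declare frob_set.simps [simp del]

lemma frob_set_0 [simp]: "frob_set p U 0 = UNIV"
  by (simp add: frob_set.simps)

lemma up_closed_frob_set [simp]: "up_closed (frob_set p U k)"
  by (subst frob_set.simps) simp

section \<open>Exponents of Frobenius powers\<close>

text \<open>The bound \<open>D\<close> expresses finite generation: every exponent in
  \<open>U\<close> lies above one in the box with side \<open>D\<close>.\<close>

locale frob_exponents =
  fixes p :: nat and U :: "('n::finite \<Rightarrow> nat) set" and D :: nat
  assumes p2: "2 \<le> p"
    and up_closed_U: "up_closed U"
    and nonempty: "U \<noteq> {}"
    and bounded: "u \<in> U \<Longrightarrow> \<exists>g\<in>U. g \<le> u \<and> (\<forall>i. g i \<le> D)"
begin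

abbreviation G :: "nat \<Rightarrow> ('n \<Rightarrow> nat) set" where "G \<equiv> frob_set p U"

lemma G_rec: "G k = up_add (up_pow U (k mod p)) (up_scale p (G (k div p)))"
  using p2 by (cases "k = 0") (simp_all add: frob_set.simps[of p U k])

lemma G_1: "G 1 = U"
  by (subst G_rec) (use p2 up_closed_U in simp)

text \<open>For \<open>j < p ^ s\<close> the base \<open>p\<close> digits of
  \<open>k * p ^ s + j\<close> are those of \<open>j\<close>, padded to length \<open>s\<close>,
  followed by those of \<open>k\<close>. No carry occurs, so the product over the digits
  splits.\<close>

lemma G_shift_add: "j < p ^ s \<Longrightarrow> G (k * p ^ s + j) = up_add (up_scale (p ^ s) (G k)) (G j)"
proof (induction s arbitrary: j)
  case (Suc s)
  have "(k * p ^ Suc s + j) mod p = (p * (k * p ^ s) + j) mod p" by (simp add: ac_simps)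
  then have m: "(k * p ^ Suc s + j) mod p = j mod p" by simp
  have "(k * p ^ Suc s + j) div p = (p * (k * p ^ s) + j) div p" by (simp add: ac_simps)
  then have d: "(k * p ^ Suc s + j) div p = k * p ^ s + j div p" using p2 by simp
  have "j div p < p ^ s" using Suc.prems p2 by (simp add: less_mult_imp_div_less mult.commute)
  then have IH: "G (k * p ^ s + j div p) = up_add (up_scale (p ^ s) (G k)) (G (j div p))"
    by (rule Suc.IH)
  show ?case
    unfolding G_rec[of "k * p ^ Suc s + j"] G_rec[of j] m d IH
    by (simp only: up_scale_up_add up_scale_up_scale power_Suc up_add_left_commute)
qed simp

text \<open>
  Monotonicity of \<open>G\<close> alone does not survive the induction through a carry; the extra factor \<open>U\<close>
  supplies the \<open>p\<close>-th factor needed in \<open>I\<^bsup>[p]\<^esup> \<subseteq> I\<^sup>p\<close>.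
\<close>

lemma G_Suc_subset: "G (Suc k) \<subseteq> up_add U (G k)"
proof (induction k rule: less_induct)
  case (less k)
  show ?case
  proof (cases "Suc (k mod p) = p")
    case False
    then have "Suc k mod p = Suc (k mod p)" "Suc k div p = k div p"
      by (auto simp: mod_Suc div_Suc)
    then show ?thesis
      by (subst G_rec, subst (2) G_rec) (simp add: up_add_assoc)
  next
    case True
    then have m: "Suc k mod p = 0" "Suc k div p = Suc (k div p)"
      by (auto simp: mod_Suc div_Suc)
    have "0 < k" using True p2 by (cases k) auto
    then have lt: "k div p < k" using p2 by simp
    have "G (Suc k) = up_scale p (G (Suc (k div p)))"
      by (subst G_rec) (simp add: m)
    also have "\<dots> \<subseteq> up_scale p (up_add U (G (k div p)))"
      by (intro up_scale_mono less.IH lt)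
    also have "\<dots> = up_add (up_scale p U) (up_scale p (G (k div p)))"
      by (rule up_scale_up_add)
    also have "\<dots> \<subseteq> up_add (up_pow U p) (up_scale p (G (k div p)))"
      by (intro up_add_mono up_scale_subset_up_pow up_closed_U order_refl)
    also have "up_pow U p = up_add U (up_pow U (k mod p))"
      by (subst True[symmetric]) simp
    also have "up_add (up_add U (up_pow U (k mod p))) (up_scale p (G (k div p))) = up_add U (G k)"
      by (subst (2) G_rec) (simp add: up_add_assoc)
    finally show ?thesis .
  qed
qed

lemma G_antimono: "j \<le> k \<Longrightarrow> G k \<subseteq> G j"
proof (induction k rule: dec_induct)
  case (step n)
  then show ?case
    using order_trans[OF G_Suc_subset up_add_subset, of n] by auto
qed auto

section \<open>Bounds on the generators of \<open>I^[k]\<close>\<close>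

lemma up_pow_bounded: "u \<in> up_pow U n \<Longrightarrow> \<exists>g\<in>up_pow U n. g \<le> u \<and> (\<forall>i. g i \<le> n * D)"
proof (induction n arbitrary: u)
  case 0
  show ?case by (auto simp: le_fun_def intro: exI[of _ "\<lambda>_. 0"])
next
  case (Suc n)
  then obtain x y where xy: "x \<in> U" "y \<in> up_pow U n" "\<And>i. x i + y i \<le> u i"
    by (auto elim: up_addE)
  obtain g where g: "g \<in> U" "\<And>i. g i \<le> x i" "\<And>i. g i \<le> D"
    using bounded[OF xy(1)] by (auto simp: le_fun_def)
  obtain h where h: "h \<in> up_pow U n" "\<And>i. h i \<le> y i" "\<And>i. h i \<le> n * D"
    using Suc.IH[OF xy(2)] by (auto simp: le_fun_def)
  show ?case
  proof (intro bexI conjI allI)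
    show "(\<lambda>i. g i + h i) \<in> up_pow U (Suc n)" using g h by (auto intro: up_addI)
    show "(\<lambda>i. g i + h i) \<le> u"
      unfolding le_fun_def using g(2) h(2) xy(3) by (meson add_mono order_trans)
    show "g i + h i \<le> Suc n * D" for i using g(3)[of i] h(3)[of i] by simp
  qed
qed

text \<open>A digit \<open>d\<close> in position \<open>i\<close> contributes generators with
  entries at most \<open>p ^ i * d * D\<close>, and these weights sum to \<open>k * D\<close>. The
  induction follows the Horner recursion.\<close>

lemma G_bounded: "u \<in> G k \<Longrightarrow> \<exists>g\<in>G k. g \<le> u \<and> (\<forall>i. g i \<le> k * D)"
proof (induction k arbitrary: u rule: less_induct)
  case (less k)
  show ?case
  proof (cases "k = 0")
    case True
    then show ?thesis by (auto simp: le_fun_def intro: exI[of _ "\<lambda>_. 0"])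
  next
    case False
    then have lt: "k div p < k" using p2 by simp
    from less.prems obtain x y where
      xy: "x \<in> up_pow U (k mod p)" "y \<in> up_scale p (G (k div p))" "\<And>i. x i + y i \<le> u i"
      by (subst (asm) G_rec) (auto elim: up_addE)
    from xy(2) obtain z where z: "z \<in> G (k div p)" "\<And>i. p * z i \<le> y i"
      by (auto elim: up_scaleE)
    obtain g where g: "g \<in> up_pow U (k mod p)" "\<And>i. g i \<le> x i" "\<And>i. g i \<le> k mod p * D"
      using up_pow_bounded[OF xy(1)] by (auto simp: le_fun_def)
    obtain h where h: "h \<in> G (k div p)" "\<And>i. h i \<le> z i" "\<And>i. h i \<le> k div p * D"
      using less.IH[OF lt z(1)] by (auto simp: le_fun_def)
    show ?thesis
    proof (intro bexI conjI allI)
      show "(\<lambda>i. g i + p * h i) \<in> G k"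
        by (subst G_rec) (use g h in \<open>auto intro!: up_addI up_scaleI\<close>)
      show "(\<lambda>i. g i + p * h i) \<le> u"
        unfolding le_fun_def
      proof
        fix i
        have "p * h i \<le> p * z i" using h(2)[of i] by simp
        then show "g i + p * h i \<le> u i" using g(2)[of i] z(2)[of i] xy(3)[of i] by linarith
      qed
      fix i
      have "g i + p * h i \<le> k mod p * D + p * (k div p * D)"
        using g(3)[of i] h(3)[of i] by (intro add_mono mult_le_mono) auto
      also have "\<dots> = (k mod p + p * (k div p)) * D" by (simp only: add_mult_distrib mult.assoc)
      finally show "g i + p * h i \<le> k * D" by simp
    qed
  qed
qed

section \<open>Exponent sets of the ideals \<open>I^[k/p^e]\<close>\<close>

definition W :: "nat \<Rightarrow> nat \<Rightarrow> ('n \<Rightarrow> nat) set" where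
  "W k e = up_div (p ^ e) (G k)"

abbreviation frac_val :: "nat \<Rightarrow> nat \<Rightarrow> real" where "frac_val k e \<equiv> real k / real (p ^ e)"

text \<open>The root of order \<open>p ^ (s + e)\<close> is taken as a \<open>p ^ s\<close>-th root
  followed by a \<open>p ^ e\<close>-th root. The projection formula pulls \<open>G k\<close> out of
  the first one. The cases \<open>j = 0\<close>, \<open>j = 1\<close> and \<open>e = 0\<close> give
  independence of the representation, right continuity and translation by integers.\<close>

lemma W_shift_add:
  assumes "j < p ^ s"
  shows "W (k * p ^ s + j) (s + e) = up_div (p ^ e) (up_add (G k) (W j s))"
proof -
  have "W (k * p ^ s + j) (s + e) = up_div (p ^ e) (up_div (p ^ s) (G (k * p ^ s + j)))"
    by (simp add: W_def up_div_up_div power_add)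
  also have "up_div (p ^ s) (G (k * p ^ s + j)) = up_add (G k) (W j s)"
    using p2 by (simp add: W_def G_shift_add[OF assms] up_div_up_add_up_scale)
  finally show ?thesis .
qed

lemma W_rescale: "W (k * p ^ s) (s + e) = W k e"
  using W_shift_add[of 0 s k e] p2 by (simp add: W_def)

lemma W_antimono:
  assumes "frac_val k e \<le> frac_val k' e'"
  shows "W k' e' \<subseteq> W k e"
proof -
  have "real (k * p ^ e') \<le> real (k' * p ^ e)"
    using assms p2 by (simp add: field_simps)
  then have "k * p ^ e' \<le> k' * p ^ e" by (simp only: of_nat_le_iff)
  \<comment> \<open>Both fractions are written over the denominator \<open>p ^ (e + e')\<close>,
    where only the numerators are compared.\<close>
  then have "W (k' * p ^ e) (e + e') \<subseteq> W (k * p ^ e') (e' + e)"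
    by (simp add: W_def add.commute up_div_mono G_antimono)
  then show ?thesis by (simp only: W_rescale)
qed


text \<open>
  The union includes the value at \<open>l\<close> itself, which is harmless by right continuity.
\<close>

definition V :: "real \<Rightarrow> ('n \<Rightarrow> nat) set" where
  "V l = \<Union>{W k e | k e. l \<le> frac_val k e}"

lemma W_subset_V: "l \<le> frac_val k e \<Longrightarrow> W k e \<subseteq> V l"
  by (auto simp: V_def)

text \<open>If \<open>k \<le> N * p ^ e\<close>, generators of \<open>I^[k]\<close> with entries at
  most \<open>k * D\<close> turn into generators of the root with entries at most
  \<open>N * D\<close>. Thus \<open>W k e\<close> is determined by its trace on the finite box
  \<open>B\<close>.\<close>

lemma finite_W_range: "finite {W k e | k e. frac_val k e \<le> real N}"
proof -
  define B where "B = {g :: 'n \<Rightarrow> nat. \<forall>i. g i \<le> N * D}"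
  have "B = (\<Pi>\<^sub>E i\<in>UNIV. {..N * D})" by (auto simp: B_def PiE_def)
  then have "finite B" by (simp add: finite_PiE)
  have "W k e = {w. \<exists>h\<in>W k e \<inter> B. h \<le> w}" if "frac_val k e \<le> real N" for k e
  proof (intro equalityI subsetI)
    fix w assume "w \<in> W k e"
    then obtain x where x: "x \<in> G k" "\<And>i. x i div p ^ e \<le> w i"
      unfolding W_def by (rule up_divE) blast
    obtain g where g: "g \<in> G k" "\<And>i. g i \<le> x i" "\<And>i. g i \<le> k * D"
      using G_bounded[OF x(1)] by (auto simp: le_fun_def)
    have "real k \<le> real (N * p ^ e)" using that p2 by (simp add: field_simps)
    then have kN: "k \<le> N * p ^ e" by (simp only: of_nat_le_iff)
    show "w \<in> {w. \<exists>h\<in>W k e \<inter> B. h \<le> w}"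
    proof (intro CollectI bexI IntI)
      show "(\<lambda>i. g i div p ^ e) \<in> W k e" unfolding W_def using g(1) by (auto intro: up_divI)
      show "(\<lambda>i. g i div p ^ e) \<le> w"
        unfolding le_fun_def using div_le_mono[OF g(2)] x(2) by (blast intro: order_trans)
      show "(\<lambda>i. g i div p ^ e) \<in> B"
        unfolding B_def
      proof (intro CollectI allI)
        fix i
        have "g i \<le> N * D * p ^ e"
          using order_trans[OF g(3)[of i] mult_le_mono1[OF kN]] by (simp add: ac_simps)
        then have "g i div p ^ e \<le> (N * D * p ^ e) div p ^ e" by (rule div_le_mono)
        then show "g i div p ^ e \<le> N * D" using p2 by simp
      qed
    qed
  next
    fix w assume "w \<in> {w. \<exists>h\<in>W k e \<inter> B. h \<le> w}"
    then show "w \<in> W k e" unfolding W_def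
      by (auto simp: le_fun_def intro: up_closedD)
  qed
  then have "{W k e | k e. frac_val k e \<le> real N} \<subseteq> (\<lambda>S. {w. \<exists>h\<in>S. h \<le> w}) ` Pow B"
    by (auto intro!: image_eqI[of _ _ "W k e \<inter> B" for k e])
  moreover have "finite ((\<lambda>S. {w. \<exists>h\<in>S. h \<le> w}) ` Pow B)"
    using \<open>finite B\<close> by simp
  ultimately show ?thesis by (rule finite_subset)
qed

section \<open>Approximation by fractions \<open>k / p ^ e\<close> and right continuity\<close>

lemma ex_inverse_power_less:
  assumes "0 < d"
  obtains s where "1 / real (p ^ s) < d"
proof -
  obtain s where "(1 / real p) ^ s < d"
    using real_arch_pow_inv[OF assms, of "1 / real p"] p2 by auto
  with that show thesis by (simp add: power_divide)
qed

lemma frac_val_dense: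
  assumes "0 \<le> a" "a < b"
  obtains k e where "a \<le> frac_val k e" "frac_val k e < b"
proof -
  obtain e where e: "1 / real (p ^ e) < b - a"
    using ex_inverse_power_less[of "b - a"] assms(2) by auto
  have pos: "real (p ^ e) > 0" using p2 by simp
  \<comment> \<open>Rounding \<open>a * p ^ e\<close> up keeps the fraction at least
    \<open>a\<close> and overshoots by less than \<open>1 / p ^ e\<close>, hence by less than
    \<open>b - a\<close>.\<close>
  define k where "k = nat \<lceil>a * real (p ^ e)\<rceil>"
  have "0 \<le> a * real (p ^ e)" using assms(1) by simp
  then have "a * real (p ^ e) \<le> real k" "real k < a * real (p ^ e) + 1"
    unfolding k_def by linarith+
  moreover from this have "frac_val k e < a + 1 / real (p ^ e)"
    using pos by (simp add: field_simps)
  ultimately show thesis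
    using e pos by (intro that[of k e]) (simp_all add: field_simps)
qed

text \<open>Once \<open>p ^ s\<close> exceeds all entries of some generator, that generator is
  rounded down to the zero vector, and the root is the unit ideal.\<close>

lemma W_1_eq_UNIV:
  assumes "D < p ^ s"
  shows "W 1 s = UNIV"
proof -
  obtain g where "g \<in> U" "\<And>i. g i \<le> D" using nonempty bounded by blast
  moreover from this have "g i div p ^ s = 0" for i
    using assms by (intro div_less) (blast intro: le_less_trans)
  ultimately show ?thesis
    using G_1 by (auto simp: W_def intro!: up_divI)
qed

text \<open>Passing from \<open>k\<close> to \<open>k * p ^ s + 1\<close> raises the fraction by
  \<open>1 / p ^ (s + e)\<close> and multiplies \<open>I^[k]\<close> by \<open>I^[1/p^s]\<close>
  before the root is taken. For large \<open>s\<close> that factor is the unit ideal.\<close>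

lemma W_right_continuous:
  assumes "frac_val k e < c"
  obtains k' e' where "frac_val k e < frac_val k' e'" "frac_val k' e' < c" "W k' e' = W k e"
proof -
  have "0 < c - frac_val k e" using assms by simp
  then obtain s0 where s0: "1 / real (p ^ s0) < c - frac_val k e"
    by (rule ex_inverse_power_less)
  \<comment> \<open>The summand \<open>s0\<close> makes the increment smaller than the gap to
    \<open>c\<close>, \<open>D\<close> ensures \<open>D < p ^ s\<close>, and \<open>Suc\<close>
    ensures \<open>1 < p ^ s\<close>, so that the added \<open>1\<close> causes no carry.\<close>
  define s where "s = Suc (s0 + D)"
  have "D < 2 ^ D" by (rule less_exp)
  also have "\<dots> \<le> 2 ^ s" unfolding s_def by (intro power_increasing) simp_all
  also have "2 ^ s \<le> p ^ s" using p2 by (rule power_mono) simp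
  finally have D: "D < p ^ s" .
  have "1 < p ^ s" using p2 unfolding s_def by (intro one_less_power) simp_all
  then have "W (k * p ^ s + 1) (s + e) = up_div (p ^ e) (up_add (G k) UNIV)"
    using W_shift_add[of 1 s k e] W_1_eq_UNIV[OF D] by simp
  then have W: "W (k * p ^ s + 1) (s + e) = W k e"
    by (simp add: W_def)
  have v: "frac_val (k * p ^ s + 1) (s + e) = frac_val k e + 1 / real (p ^ (s + e))"
    using p2 by (simp add: power_add field_simps)
  have "p ^ s0 \<le> p ^ (s + e)"
    using p2 by (intro power_increasing) (auto simp: s_def)
  then have "1 / real (p ^ (s + e)) \<le> 1 / real (p ^ s0)"
    using p2 by (intro divide_left_mono) simp_all
  with s0 have "frac_val (k * p ^ s + 1) (s + e) < c" unfolding v by linarith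
  moreover have "frac_val k e < frac_val (k * p ^ s + 1) (s + e)"
    unfolding v using p2 by simp
  ultimately show thesis using that W by blast
qed

text \<open>Only finitely many sets \<open>W k e\<close> occur just above \<open>l\<close>, so a
  maximal one exists. As \<open>W\<close> decreases with the fraction, every fraction strictly
  between \<open>l\<close> and the one attaining the maximum has the same set.\<close>

lemma V_stable:
  assumes "0 \<le> l"
  obtains c where "l < c" "\<And>k e. l \<le> frac_val k e \<Longrightarrow> frac_val k e < c \<Longrightarrow> W k e = V l"
proof -
  obtain N :: nat where N: "l < real N" using reals_Archimedean2 by blast
  define F where "F = {W k e | k e. l < frac_val k e \<and> frac_val k e \<le> real N}"
  have "F \<subseteq> {W k e | k e. frac_val k e \<le> real N}" by (auto simp: F_def)
  then have "finite F" using finite_W_range finite_subset by blast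
  have "W N 0 \<in> F" unfolding F_def using N by (intro CollectI exI[of _ N] exI[of _ 0]) simp
  then obtain M where M: "M \<in> F" "\<And>X. X \<in> F \<Longrightarrow> M \<subseteq> X \<Longrightarrow> M = X"
    using finite_has_maximal[OF \<open>finite F\<close>] by blast
  from M(1) obtain k0 e0 where
    c: "M = W k0 e0" "l < frac_val k0 e0" "frac_val k0 e0 \<le> real N" by (auto simp: F_def)
  have gt: "W k e = M" if "l < frac_val k e" "frac_val k e < frac_val k0 e0" for k e
  proof -
    have "W k e \<in> F" unfolding F_def using that c(3) by (intro CollectI exI[of _ k] exI[of _ e]) simp
    moreover have "M \<subseteq> W k e" unfolding c(1) using that by (intro W_antimono) simp
    ultimately show ?thesis using M(2) by blast
  qed
  \<comment> \<open>A fraction equal to \<open>l\<close> is moved slightly to the right without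
    changing its set, which reduces to the strict case.\<close>
  have ge: "W k e = M" if "l \<le> frac_val k e" "frac_val k e < frac_val k0 e0" for k e
  proof -
    note le = that(1) and less = that(2)
    obtain k' e' where *: "frac_val k e < frac_val k' e'" "frac_val k' e' < frac_val k0 e0"
      "W k' e' = W k e"
      using W_right_continuous[OF less] by metis
    from gt[of k' e'] * le show ?thesis by simp
  qed
  have "W k e \<subseteq> M" if "l \<le> frac_val k e" for k e
  proof (cases "frac_val k e < frac_val k0 e0")
    case True
    with ge that show ?thesis by blast
  next
    case False
    then show ?thesis unfolding c(1) by (intro W_antimono) simp
  qed
  then have "V l \<subseteq> M" by (auto simp: V_def)
  moreover have "M \<subseteq> V l" unfolding c(1) using c(2) by (intro W_subset_V) simp
  ultimately have "M = V l" by blast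
  with ge c(2) that[of "frac_val k0 e0"] show thesis by blast
qed

section \<open>Translation by integers and multiplication by \<open>p\<close>\<close>

lemma V_add_nat:
  assumes "0 \<le> l" "l < 1"
  shows "V (real n + l) = up_add (G n) (V l)"
proof -
  obtain c where c: "l < c" "\<And>k e. l \<le> frac_val k e \<Longrightarrow> frac_val k e < c \<Longrightarrow> W k e = V l"
    using V_stable assms(1) by blast
  have "0 \<le> real n + l" using assms(1) by simp
  then obtain c' where c': "real n + l < c'"
    "\<And>k e. real n + l \<le> frac_val k e \<Longrightarrow> frac_val k e < c' \<Longrightarrow> W k e = V (real n + l)"
    using V_stable by blast
  \<comment> \<open>Below \<open>c\<close> the fraction computes \<open>V l\<close>, below
    \<open>c' - n\<close> its translate computes \<open>V (n + l)\<close>, and below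
    \<open>1\<close> its numerator is less than \<open>p ^ e\<close>, so adding \<open>n\<close>
    causes no carry.\<close>
  have "l < Min {c, c' - real n, 1}" using c(1) c'(1) assms(2) by simp
  then obtain k e where k: "l \<le> frac_val k e" "frac_val k e < Min {c, c' - real n, 1}"
    using frac_val_dense assms(1) by blast
  have pos: "real (p ^ e) > 0" using p2 by simp
  have "real k < real (p ^ e)" using k(2) pos by (simp add: field_simps)
  then have kl: "k < p ^ e" by (simp only: of_nat_less_iff)
  have v: "frac_val (n * p ^ e + k) e = real n + frac_val k e"
    using pos by (simp add: field_simps)
  have "V (real n + l) = W (n * p ^ e + k) e"
    using c'(2)[of "n * p ^ e + k" e] k unfolding v by simp
  also have "\<dots> = up_add (G n) (W k e)"
    using W_shift_add[OF kl, of n 0] by simp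
  also have "W k e = V l" using c(2) k by simp
  finally show ?thesis .
qed

text \<open>A fraction \<open>k / p ^ e\<close> slightly above \<open>p * l\<close> yields
  \<open>k / p ^ (e + 1)\<close> slightly above \<open>l\<close>, with the same numerator and one
  more \<open>p\<close>-th root.\<close>

lemma V_eq_up_div:
  assumes "0 \<le> l"
  shows "V l = up_div p (V (real p * l))"
proof -
  obtain c where c: "l < c" "\<And>k e. l \<le> frac_val k e \<Longrightarrow> frac_val k e < c \<Longrightarrow> W k e = V l"
    using V_stable assms by blast
  have p0: "real p > 0" using p2 by simp
  have pl: "0 \<le> real p * l" using assms by simp
  then obtain c' where c': "real p * l < c'"
    "\<And>k e. real p * l \<le> frac_val k e \<Longrightarrow> frac_val k e < c' \<Longrightarrow> W k e = V (real p * l)"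
    using V_stable by blast
  have "real p * l < min (real p * c) c'" using c(1) c'(1) p0 by simp
  then obtain k e where k: "real p * l \<le> frac_val k e" "frac_val k e < min (real p * c) c'"
    using frac_val_dense pl by blast
  have v: "frac_val k e = real p * frac_val k (Suc e)" using p0 by simp
  have "real p * l \<le> real p * frac_val k (Suc e)" "real p * frac_val k (Suc e) < real p * c"
    using k unfolding v by simp_all
  then have "l \<le> frac_val k (Suc e)" "frac_val k (Suc e) < c"
    unfolding mult_le_cancel_left_pos[OF p0] mult_less_cancel_left_pos[OF p0] by this+
  then have "V l = W k (Suc e)" using c(2) by simp
  also have "\<dots> = up_div p (W k e)" by (simp add: W_def up_div_up_div mult.commute)
  also have "W k e = V (real p * l)" using c'(2) k by simp
  finally show ?thesis .
qed

section \<open>Critical exponents as jumps of \<open>V\<close>\<close>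

definition jump :: "real \<Rightarrow> bool" where
  "jump l \<longleftrightarrow> 0 < l \<and> (\<forall>m. 0 \<le> m \<and> m < l \<longrightarrow> V m \<noteq> V l)"

text \<open>Taking \<open>p\<close>-th roots turns an equality \<open>V m = V (p * l)\<close> into
  \<open>V (m / p) = V l\<close>, where \<open>m / p < l\<close>.\<close>

lemma jump_mult:
  assumes "jump l"
  shows "jump (real p * l)"
  unfolding jump_def
proof (intro conjI allI impI notI)
  have p0: "real p > 0" using p2 by simp
  show "0 < real p * l" using assms p0 by (simp add: jump_def)
  fix m assume m: "0 \<le> m \<and> m < real p * l" "V m = V (real p * l)"
  have "V (m / real p) = up_div p (V m)"
    using V_eq_up_div[of "m / real p"] m(1) p0 by simp
  also have "\<dots> = V l" unfolding m(2) using V_eq_up_div assms by (simp add: jump_def)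
  finally have "V (m / real p) = V l" .
  moreover have "0 \<le> m / real p" "m / real p < l"
    using m(1) p0 by (simp_all add: pos_divide_less_eq mult.commute)
  ultimately show False using assms unfolding jump_def by blast
qed

lemma jump_power: "jump l \<Longrightarrow> jump (real (p ^ e) * l)"
proof (induction e)
  case (Suc e)
  then show ?case using jump_mult[of "real (p ^ e) * l"] by (simp add: mult.assoc)
qed simp

text \<open>Multiplying by \<open>I^[n]\<close> with \<open>n\<close> the integral part of
  \<open>l\<close> carries \<open>V m = V (frac l)\<close> to an equality at \<open>n + m\<close>
  and \<open>l\<close>.\<close>

lemma jump_frac:
  assumes "jump l" "frac l \<noteq> 0"
  shows "jump (frac l)"
  unfolding jump_def
proof (intro conjI allI impI notI)
  show "0 < frac l" using assms(2) frac_ge_0[of l] by linarith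
  fix m assume m: "0 \<le> m \<and> m < frac l" "V m = V (frac l)"
  have l: "l = real (nat \<lfloor>l\<rfloor>) + frac l"
    using assms(1) by (simp add: frac_def jump_def)
  have "V (real (nat \<lfloor>l\<rfloor>) + m) = V l"
  proof -
    have "V (real (nat \<lfloor>l\<rfloor>) + m) = up_add (G (nat \<lfloor>l\<rfloor>)) (V m)"
      using m(1) frac_lt_1[of l] by (intro V_add_nat) auto
    also have "\<dots> = V (real (nat \<lfloor>l\<rfloor>) + frac l)"
      unfolding m(2) by (rule V_add_nat[symmetric]) (simp_all add: frac_lt_1)
    finally show ?thesis by (simp only: l[symmetric])
  qed
  moreover have "0 \<le> real (nat \<lfloor>l\<rfloor>) + m" "real (nat \<lfloor>l\<rfloor>) + m < l" using m(1) l by linarith+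
  ultimately show False using assms(1) unfolding jump_def by blast
qed

text \<open>Jumps with the same value of \<open>V\<close> coincide, since neither can lie below the
  other. For \<open>l < 1\<close> the set \<open>V l\<close> is one of the finitely many
  \<open>W k e\<close> with fraction at most \<open>1\<close>.\<close>

lemma finite_jumps: "finite {l. jump l \<and> l < 1}"
proof (rule finite_imageD)
  have "V l \<in> {W k e | k e. frac_val k e \<le> real 1}" if "jump l" "l < 1" for l
  proof -
    have l0: "0 \<le> l" using that(1) by (simp add: jump_def)
    then obtain c where c: "l < c" "\<And>k e. l \<le> frac_val k e \<Longrightarrow> frac_val k e < c \<Longrightarrow> W k e = V l"
      using V_stable by blast
    have "l < min c 1" using c(1) that(2) by simp
    then obtain k e where k: "l \<le> frac_val k e" "frac_val k e < min c 1"
      using frac_val_dense l0 by blast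
    then have "V l = W k e" using c(2) by simp
    then show ?thesis using k(2) by (intro CollectI exI[of _ k] exI[of _ e]) simp
  qed
  then have "V ` {l. jump l \<and> l < 1} \<subseteq> {W k e | k e. frac_val k e \<le> real 1}" by blast
  then show "finite (V ` {l. jump l \<and> l < 1})" by (rule finite_subset[OF _ finite_W_range])
  show "inj_on V {l. jump l \<and> l < 1}"
  proof (rule inj_onI)
    fix x y assume *: "x \<in> {l. jump l \<and> l < 1}" "y \<in> {l. jump l \<and> l < 1}" "V x = V y"
    from * have "0 \<le> x" "0 \<le> y" by (simp_all add: jump_def)
    with * have "\<not> x < y" "\<not> y < x" unfolding mem_Collect_eq jump_def by metis+
    then show "x = y" by simp
  qed
qed

lemma jump_rational:
  assumes "jump l"
  shows "l \<in> \<rat>"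
proof -
  define f where "f e = frac (real (p ^ e) * l)" for e
  have fl: "f e = real (p ^ e) * l - of_int \<lfloor>real (p ^ e) * l\<rfloor>" for e
    by (simp add: f_def frac_def)
  \<comment> \<open>The value \<open>0\<close> accounts for an integral \<open>p ^ e * l\<close>,
    where the fractional part is no jump.\<close>
  have "f e \<in> insert 0 {l. jump l \<and> l < 1}" for e
    using jump_frac[OF jump_power[OF assms], of e] frac_lt_1[of "real (p ^ e) * l"]
    unfolding f_def by blast
  then have "finite (range f)"
    using finite_jumps by (meson finite_insert finite_subset image_subsetI)
  then have "\<not> inj f" using finite_imageD infinite_UNIV_nat by blast
  then obtain a b where ab: "a \<noteq> b" "f a = f b" by (auto simp: inj_def)
  define d where "d = \<lfloor>real (p ^ a) * l\<rfloor> - \<lfloor>real (p ^ b) * l\<rfloor>"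
  have ne: "real (p ^ a) - real (p ^ b) \<noteq> 0" using ab(1) p2 by simp
  \<comment> \<open>Numbers with equal fractional parts differ by the difference \<open>d\<close> of
    their floors.\<close>
  have "(real (p ^ a) - real (p ^ b)) * l = of_int d"
    using ab(2) unfolding fl d_def by (simp add: algebra_simps)
  then have "l = of_int d / (real (p ^ a) - real (p ^ b))"
    using ne by (simp add: field_simps)
  then show ?thesis by simp
qed

end

section \<open>Monomial ideals\<close>

text \<open>Over a finite index type all functions have finite support, so exponent vectors can be
  treated as plain functions.\<close>

lemma lookup_Abs_finite [simp]:
  fixes u :: "'n::finite \<Rightarrow> 'b::zero"
  shows "Poly_Mapping.lookup (Abs_poly_mapping u) = u"
  by (rule lookup_Abs_poly_mapping) simp

lemma sum_single_lookup:
  fixes f :: "'a \<Rightarrow>\<^sub>0 'b::comm_monoid_add"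
  shows "(\<Sum>a\<in>Poly_Mapping.keys f. Poly_Mapping.single a (Poly_Mapping.lookup f a)) = f"
  by (rule poly_mapping_eqI)
    (simp add: lookup_sum lookup_single when_def in_keys_iff if_distrib cong: if_cong)

text \<open>Every polynomial is a finite sum of terms; the empty sum is a term with coefficient
  \<open>0\<close>. This is the form in which additive identities are checked.\<close>

lemma poly_mapping_single_induct [case_names single add]:
  fixes f :: "'a \<Rightarrow>\<^sub>0 'b::comm_monoid_add"
  assumes single: "\<And>a c. P (Poly_Mapping.single a c)"
    and add: "\<And>f g. P f \<Longrightarrow> P g \<Longrightarrow> P (f + g)"
  shows "P f"
proof -
  have P0: "P 0" using single[of _ 0] by simp
  have "P (\<Sum>a\<in>S. Poly_Mapping.single a (Poly_Mapping.lookup f a))" if "finite S" for S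
    using that by (induction S) (simp_all add: single add P0)
  from this[of "Poly_Mapping.keys f"] show ?thesis by (simp add: sum_single_lookup)
qed

section \<open>Ideals spanned by monomials and their products\<close>

definition monomial_span :: "('n \<Rightarrow> nat) set \<Rightarrow> ('n, 'k::field) mpoly set" where
  "monomial_span X = {f. \<forall>a\<in>Poly_Mapping.keys f. Poly_Mapping.lookup a \<in> X}"

lemma monomial_in_monomial_span [simp]:
  "monomial a \<in> monomial_span X \<longleftrightarrow> Poly_Mapping.lookup a \<in> X"
  by (simp add: monomial_span_def monomial_def)

lemma monomial_span_UNIV [simp]: "monomial_span UNIV = UNIV"
  by (simp add: monomial_span_def)

lemma is_idealD:
  assumes "is_ideal L"
  shows ideal_zero: "0 \<in> L" and ideal_plus: "f \<in> L \<Longrightarrow> g \<in> L \<Longrightarrow> f + g \<in> L"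
    and ideal_times: "f \<in> L \<Longrightarrow> h * f \<in> L"
  using assms by (auto simp: module.subspace_def[OF module_times])

lemma ideal_gen_minimal: "S \<subseteq> L \<Longrightarrow> is_ideal L \<Longrightarrow> ideal_gen S \<subseteq> L"
  by (rule module.span_minimal[OF module_times])

lemma is_ideal_ideal_gen: "is_ideal (ideal_gen S)"
  by (rule module.subspace_span[OF module_times])

lemma ideal_gen_base: "s \<in> S \<Longrightarrow> s \<in> ideal_gen S"
  by (rule module.span_base[OF module_times])

lemma is_ideal_monomial_span:
  fixes X :: "('n::finite \<Rightarrow> nat) set"
  assumes "up_closed X"
  shows "is_ideal (monomial_span X :: ('n, 'k::field) mpoly set)"
  unfolding module.subspace_def[OF module_times]
proof (intro conjI ballI allI)
  show "0 \<in> (monomial_span X :: ('n, 'k) mpoly set)" by (simp add: monomial_span_def)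
next
  fix f g :: "('n, 'k) mpoly" assume "f \<in> monomial_span X" "g \<in> monomial_span X"
  then show "f + g \<in> monomial_span X"
    using Poly_Mapping.keys_add[of f g] unfolding monomial_span_def by blast
next
  fix h f :: "('n, 'k) mpoly" assume f: "f \<in> monomial_span X"
  show "h * f \<in> monomial_span X"
    unfolding monomial_span_def
  proof (intro CollectI ballI)
    fix c assume "c \<in> Poly_Mapping.keys (h * f)"
    then obtain a b where "b \<in> Poly_Mapping.keys f" "c = a + b"
      using keys_mult[of h f] by blast
    moreover from this have "Poly_Mapping.lookup b \<in> X" using f by (simp add: monomial_span_def)
    ultimately show "Poly_Mapping.lookup c \<in> X"
      using up_closedD[OF assms] by (simp add: lookup_add)
  qed
qed

lemma single_eq_monomial: "Poly_Mapping.single a c = Poly_Mapping.single 0 c * monomial a"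
  by (simp add: monomial_def mult_single)

lemma monomial_mult: "monomial a * monomial b = monomial (a + b)"
  by (simp add: monomial_def mult_single)

lemma monomial_span_subset:
  fixes L :: "('n::finite, 'k::field) mpoly set"
  assumes L: "is_ideal L" and "\<And>a. Poly_Mapping.lookup a \<in> X \<Longrightarrow> monomial a \<in> L"
  shows "monomial_span X \<subseteq> L"
proof
  fix f :: "('n, 'k) mpoly" assume f: "f \<in> monomial_span X"
  have "(\<Sum>a\<in>S. Poly_Mapping.single a (Poly_Mapping.lookup f a)) \<in> L"
    if "finite S" "S \<subseteq> Poly_Mapping.keys f" for S
    using that
  proof (induction S)
    case (insert a S)
    then have "monomial a \<in> L" using f assms(2) by (auto simp: monomial_span_def)
    then have "Poly_Mapping.single a (Poly_Mapping.lookup f a) \<in> L"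
      by (subst single_eq_monomial) (rule ideal_times[OF L])
    with insert show ?case by (simp add: ideal_plus[OF L])
  qed (simp add: ideal_zero[OF L])
  from this[of "Poly_Mapping.keys f"] show "f \<in> L" by (simp add: sum_single_lookup)
qed

lemma lookup_le_add_diff:
  fixes a b :: "'n::finite \<Rightarrow>\<^sub>0 nat"
  assumes "\<And>i. Poly_Mapping.lookup a i \<le> Poly_Mapping.lookup b i"
  shows "b = (b - a) + a"
  by (rule poly_mapping_eqI) (use assms in \<open>simp add: lookup_add lookup_minus\<close>)

lemma ideal_monomial_mono:
  fixes L :: "('n::finite, 'k::field) mpoly set"
  assumes "is_ideal L" "monomial a \<in> L"
    and "\<And>i. Poly_Mapping.lookup a i \<le> Poly_Mapping.lookup b i"
  shows "monomial b \<in> L"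
proof -
  have "monomial b = monomial (b - a) * (monomial a :: ('n, 'k) mpoly)"
    unfolding monomial_mult by (simp only: lookup_le_add_diff[OF assms(3), symmetric])
  with ideal_times[OF assms(1,2)] show ?thesis by simp
qed

lemma ideal_gen_monomials:
  fixes A :: "('n::finite \<Rightarrow>\<^sub>0 nat) set"
  shows "(ideal_gen (monomial ` A) :: ('n, 'k::field) mpoly set)
    = monomial_span {u. \<exists>a\<in>A. Poly_Mapping.lookup a \<le> u}"
    (is "?L = monomial_span ?X")
proof
  have "up_closed ?X" by (auto simp: up_closed_def intro: order_trans)
  then show "?L \<subseteq> monomial_span ?X"
    by (intro ideal_gen_minimal is_ideal_monomial_span) auto
  show "monomial_span ?X \<subseteq> ?L"
  proof (rule monomial_span_subset[OF is_ideal_ideal_gen])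
    fix b assume "Poly_Mapping.lookup b \<in> ?X"
    then obtain a where a: "a \<in> A" "Poly_Mapping.lookup a \<le> Poly_Mapping.lookup b" by blast
    then have "monomial a \<in> ?L" by (intro ideal_gen_base) simp
    then show "monomial b \<in> ?L"
      by (rule ideal_monomial_mono[OF is_ideal_ideal_gen]) (use a(2) in \<open>simp add: le_fun_def\<close>)
  qed
qed

lemma ideal_mult_monomial_span:
  fixes X Y :: "('n::finite \<Rightarrow> nat) set"
  assumes X: "up_closed X" and Y: "up_closed Y"
  shows "ideal_mult (monomial_span X) (monomial_span Y)
    = (monomial_span (up_add X Y) :: ('n, 'k::field) mpoly set)"
proof
  show "ideal_mult (monomial_span X) (monomial_span Y)
    \<subseteq> (monomial_span (up_add X Y) :: ('n, 'k) mpoly set)"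
    unfolding ideal_mult_def
  proof (intro ideal_gen_minimal is_ideal_monomial_span up_closed_up_add subsetI)
    fix h assume "h \<in> {f * g :: ('n, 'k) mpoly | f g. f \<in> monomial_span X \<and> g \<in> monomial_span Y}"
    then obtain f g where fg: "h = f * g" "f \<in> monomial_span X" "g \<in> monomial_span Y" by blast
    show "h \<in> monomial_span (up_add X Y)"
      unfolding monomial_span_def
    proof (intro CollectI ballI)
      fix c assume "c \<in> Poly_Mapping.keys h"
      then obtain a b where "a \<in> Poly_Mapping.keys f" "b \<in> Poly_Mapping.keys g" "c = a + b"
        unfolding fg(1) using keys_mult[of f g] by blast
      with fg(2,3) show "Poly_Mapping.lookup c \<in> up_add X Y"
        by (intro up_addI[of "Poly_Mapping.lookup a" _ "Poly_Mapping.lookup b"])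
          (auto simp: monomial_span_def lookup_add)
    qed
  qed
  show "(monomial_span (up_add X Y) :: ('n, 'k) mpoly set)
    \<subseteq> ideal_mult (monomial_span X) (monomial_span Y)"
    unfolding ideal_mult_def
  proof (rule monomial_span_subset[OF is_ideal_ideal_gen])
    fix c assume "Poly_Mapping.lookup c \<in> up_add X Y"
    then obtain x y where xy: "x \<in> X" "y \<in> Y" "\<And>i. x i + y i \<le> Poly_Mapping.lookup c i"
      by (rule up_addE) blast
    \<comment> \<open>The factor from \<open>X\<close> is taken exactly, and all the excess goes to
      the other one: \<open>c - a\<close> lies above \<open>y\<close>, hence in \<open>Y\<close> by
      up-closedness.\<close>
    define a where "a = Abs_poly_mapping x"
    have xc: "x i \<le> Poly_Mapping.lookup c i" for i using xy(3)[of i] by linarith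
    have "c = (c - a) + a" by (rule lookup_le_add_diff) (simp add: a_def xc)
    then have c: "monomial c = monomial a * (monomial (c - a) :: ('n, 'k) mpoly)"
      by (metis monomial_mult add.commute)
    have "y i \<le> Poly_Mapping.lookup (c - a) i" for i
      using xy(3)[of i] by (simp add: a_def lookup_minus)
    then have "Poly_Mapping.lookup (c - a) \<in> Y" using up_closedD[OF Y xy(2)] by blast
    then have "(monomial (c - a) :: ('n, 'k) mpoly) \<in> monomial_span Y" by simp
    moreover have "(monomial a :: ('n, 'k) mpoly) \<in> monomial_span X" by (simp add: a_def xy(1))
    ultimately show "(monomial c :: ('n, 'k) mpoly)
        \<in> ideal_gen {f * g | f g. f \<in> monomial_span X \<and> g \<in> monomial_span Y}"
      unfolding c
      by (intro ideal_gen_base) blast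
  qed
qed

lemma ideal_pow_monomial_span:
  fixes X :: "('n::finite \<Rightarrow> nat) set"
  assumes "up_closed X"
  shows "ideal_pow (monomial_span X :: ('n, 'k::field) mpoly set) n = monomial_span (up_pow X n)"
  by (induction n) (simp_all add: ideal_mult_monomial_span assms)

section \<open>Frobenius on polynomials: bracket powers and a trace\<close>

definition smult_exp :: "nat \<Rightarrow> ('n::finite \<Rightarrow>\<^sub>0 nat) \<Rightarrow> ('n \<Rightarrow>\<^sub>0 nat)" where
  "smult_exp q a = Abs_poly_mapping (\<lambda>i. q * Poly_Mapping.lookup a i)"

lemma lookup_smult_exp [simp]: "Poly_Mapping.lookup (smult_exp q a) i = q * Poly_Mapping.lookup a i"
  by (simp add: smult_exp_def)

lemma smult_exp_add: "smult_exp q (a + b) = smult_exp q a + smult_exp q b"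
  by (rule poly_mapping_eqI) (simp add: lookup_add algebra_simps)

lemma single_power:
  fixes c :: "'k::field"
  shows "Poly_Mapping.single a c ^ q = Poly_Mapping.single (smult_exp q a) (c ^ q)"
proof (induction q)
  case 0
  have "smult_exp 0 a = 0" by (rule poly_mapping_eqI) simp
  then show ?case by simp
next
  case (Suc q)
  have "smult_exp (Suc q) a = a + smult_exp q a" by (rule poly_mapping_eqI) (simp add: lookup_add)
  with Suc show ?case by (simp add: mult_single)
qed

text \<open>A natural number is a constant polynomial, so it vanishes iff its coefficient at
  exponent \<open>0\<close> does.\<close>

lemma CHAR_mpoly: "CHAR(('n, 'k::field) mpoly) = CHAR('k)"
proof (rule CHAR_eqI)
  show "of_nat CHAR('k) = (0 :: ('n, 'k) mpoly)"
    by (rule poly_mapping_eqI) (simp add: lookup_of_nat)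
  fix n assume "of_nat n = (0 :: ('n, 'k) mpoly)"
  then have "Poly_Mapping.lookup (of_nat n :: ('n, 'k) mpoly) 0 = 0" by simp
  then have "of_nat n = (0 :: 'k)" by (simp add: lookup_of_nat)
  then show "CHAR('k) dvd n" by (simp add: of_nat_eq_0_iff_char_dvd)
qed

context
  fixes p e q :: nat
  assumes prime: "prime p" and CHAR: "CHAR('k::field) = p" and q: "q = p ^ e"
begin

lemma frob_add: "(x + y :: 'k) ^ q = x ^ q + y ^ q"
  using prime CHAR q by (intro freshmans_dream') simp_all

lemma frob_add_mpoly: "(f + g :: ('n, 'k) mpoly) ^ q = f ^ q + g ^ q"
  using prime CHAR q by (intro freshmans_dream') (simp_all add: CHAR_mpoly)

lemma q_pos: "0 < q"
  using prime q by (simp add: prime_gt_0_nat)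

text \<open>A splitting of Frobenius on the field. Letting \<open>c\<close> act as multiplication by
  \<open>c ^ q\<close> makes the field a vector space over itself, because \<open>q\<close>-th
  powers are additive. The nonzero vector \<open>1\<close> is independent, so a linear functional
  with value \<open>1\<close> there exists.\<close>

lemma ex_frob_functional:
  obtains \<phi> :: "'k \<Rightarrow> 'k" where "\<phi> 1 = 1" "\<And>x y. \<phi> (x + y) = \<phi> x + \<phi> y"
    "\<And>c x. \<phi> (c ^ q * x) = c * \<phi> x"
proof -
  interpret vs: vector_space_pair "\<lambda>c x :: 'k. c ^ q * x" "(*) :: 'k \<Rightarrow> 'k \<Rightarrow> 'k"
    by unfold_locales (simp_all add: frob_add algebra_simps)
  have "vs.vs1.independent {1}" by (simp add: vs.vs1.independent_insert)
  then obtain g where g: "Vector_Spaces.linear (\<lambda>c x. c ^ q * x) (*) g" "\<forall>x\<in>{1}. g x = (1 :: 'k)"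
    using vs.linear_independent_extend[of "{1}" "\<lambda>_. 1"] by blast
  interpret g: Vector_Spaces.linear "\<lambda>c x. c ^ q * x" "(*)" g by (rule g(1))
  show thesis
    by (rule that[of g]) (use g(2) in \<open>simp_all add: g.add g.scale\<close>)
qed

text \<open>The \<open>q\<close>-th power of a sum of terms is the sum of their \<open>q\<close>-th
  powers, and these have exponents in \<open>up_scale q X\<close>. Conversely each monomial with
  exponent above \<open>q * x\<close> is a multiple of a \<open>q\<close>-th power.\<close>

lemma bracket_pow_monomial_span:
  fixes X :: "('n::finite \<Rightarrow> nat) set"
  assumes "up_closed X"
  shows "bracket_pow q (monomial_span X :: ('n, 'k) mpoly set) = monomial_span (up_scale q X)"
proof
  show "bracket_pow q (monomial_span X :: ('n, 'k) mpoly set) \<subseteq> monomial_span (up_scale q X)"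
    unfolding bracket_pow_def
  proof (intro ideal_gen_minimal is_ideal_monomial_span up_closed_up_scale subsetI)
    fix h assume "h \<in> {f ^ q :: ('n, 'k) mpoly | f. f \<in> monomial_span X}"
    then obtain f where f: "h = f ^ q" "f \<in> monomial_span X" by blast
    let ?M = "monomial_span (up_scale q X) :: ('n, 'k) mpoly set"
    have M: "is_ideal ?M" by (rule is_ideal_monomial_span) simp
    have "(\<Sum>a\<in>S. Poly_Mapping.single a (Poly_Mapping.lookup f a)) ^ q \<in> ?M"
      if "finite S" "S \<subseteq> Poly_Mapping.keys f" for S
      using that
    proof (induction S)
      case empty
      show ?case using q_pos by (simp add: ideal_zero[OF M] power_0_left)
    next
      case (insert a S)
      have "Poly_Mapping.lookup a \<in> X" using insert f(2) by (auto simp: monomial_span_def)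
      then have "Poly_Mapping.single a (Poly_Mapping.lookup f a) ^ q \<in> ?M"
        by (auto simp: single_power monomial_span_def intro: up_scaleI)
      with insert show ?case by (simp add: frob_add_mpoly ideal_plus[OF M])
    qed
    from this[of "Poly_Mapping.keys f"] show "h \<in> ?M" by (simp add: sum_single_lookup f(1))
  qed
  show "(monomial_span (up_scale q X) :: ('n, 'k) mpoly set) \<subseteq> bracket_pow q (monomial_span X)"
    unfolding bracket_pow_def
  proof (rule monomial_span_subset[OF is_ideal_ideal_gen])
    fix c assume "Poly_Mapping.lookup c \<in> up_scale q X"
    then obtain x where x: "x \<in> X" "\<And>i. q * x i \<le> Poly_Mapping.lookup c i"
      by (rule up_scaleE) blast
    have "(monomial (Abs_poly_mapping x) :: ('n, 'k) mpoly) \<in> monomial_span X"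
      using x(1) by simp
    then have "(monomial (Abs_poly_mapping x) :: ('n, 'k) mpoly) ^ q
        \<in> ideal_gen {f ^ q | f. f \<in> monomial_span X}"
      by (intro ideal_gen_base) blast
    then have "(monomial (smult_exp q (Abs_poly_mapping x)) :: ('n, 'k) mpoly)
        \<in> ideal_gen {f ^ q | f. f \<in> monomial_span X}"
      by (simp add: monomial_def single_power)
    then show "(monomial c :: ('n, 'k) mpoly) \<in> ideal_gen {f ^ q | f. f \<in> monomial_span X}"
      by (rule ideal_monomial_mono[OF is_ideal_ideal_gen]) (simp add: x(2))
  qed
qed

text \<open>
  The map \<open>T\<close> below is a trace of Frobenius: it is additive, sends \<open>g h\<^sup>q\<close> to \<open>T g h\<close>, hence maps
  \<open>L\<^bsup>[q]\<^esup>\<close> into \<open>L\<close>, and takes the monomial with exponent \<open>a\<close> to the one with exponent \<open>a div q\<close>.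
\<close>

lemma monomial_div_in_ideal:
  fixes L :: "('n::finite, 'k) mpoly set" and a :: "'n \<Rightarrow>\<^sub>0 nat"
  assumes L: "is_ideal L" and a: "monomial a \<in> bracket_pow q L"
  shows "monomial (Abs_poly_mapping (\<lambda>i. Poly_Mapping.lookup a i div q)) \<in> L"
proof -
  obtain \<phi> :: "'k \<Rightarrow> 'k" where \<phi>: "\<phi> 1 = 1" "\<And>x y. \<phi> (x + y) = \<phi> x + \<phi> y"
    "\<And>c x. \<phi> (c ^ q * x) = c * \<phi> x"
    using ex_frob_functional by blast
  have \<phi>0: "\<phi> 0 = 0" using \<phi>(3)[of 0 0] by simp
  have \<phi>4: "\<phi> (x * c ^ q) = \<phi> x * c" for x c
    using \<phi>(3)[of c x] by (simp add: mult.commute)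
  \<comment> \<open>The range of \<open>s\<close> consists of all exponents congruent to that of
    \<open>a\<close> modulo \<open>q\<close>. The map \<open>T\<close> reads off only these
    coefficients, applying the splitting \<open>\<phi>\<close> to each.\<close>
  define r where "r = Abs_poly_mapping (\<lambda>i. Poly_Mapping.lookup a i mod q)"
  define s where "s b = r + smult_exp q b" for b
  define T :: "('n, 'k) mpoly \<Rightarrow> ('n, 'k) mpoly" where
    "T f = Abs_poly_mapping (\<lambda>b. \<phi> (Poly_Mapping.lookup f (s b)))" for f
  have lookup_s: "Poly_Mapping.lookup (s b) i
      = Poly_Mapping.lookup a i mod q + q * Poly_Mapping.lookup b i" for b i
    by (simp add: s_def r_def lookup_add)
  have inj_s: "inj s"
  proof (rule injI)
    fix b b' assume "s b = s b'"
    then have "Poly_Mapping.lookup (s b) i = Poly_Mapping.lookup (s b') i" for i by simp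
    then show "b = b'" unfolding lookup_s using q_pos by (auto intro: poly_mapping_eqI)
  qed
  have lookup_T: "Poly_Mapping.lookup (T f) b = \<phi> (Poly_Mapping.lookup f (s b))" for f b
  proof -
    have "finite (s -` Poly_Mapping.keys f)" by (simp add: finite_vimageI inj_s)
    moreover have "{b. \<phi> (Poly_Mapping.lookup f (s b)) \<noteq> 0} \<subseteq> s -` Poly_Mapping.keys f"
      by (auto simp: in_keys_iff \<phi>0)
    ultimately have "finite {b. \<phi> (Poly_Mapping.lookup f (s b)) \<noteq> 0}"
      by (rule rev_finite_subset)
    then show ?thesis by (simp add: T_def)
  qed
  have T_add: "T (f + g) = T f + T g" for f g
    by (rule poly_mapping_eqI) (simp add: lookup_T lookup_add \<phi>(2))
  have T_single: "T (Poly_Mapping.single (s b) c) = Poly_Mapping.single b (\<phi> c)" for b c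
    by (rule poly_mapping_eqI)
      (use inj_s in \<open>auto simp: lookup_T lookup_single when_def \<phi>0 inj_eq\<close>)
  have T_single_0: "T (Poly_Mapping.single b c) = 0" if "b \<notin> range s" for b c
    by (rule poly_mapping_eqI) (use that in \<open>auto simp: lookup_T lookup_single when_def \<phi>0\<close>)
  have T_mult_single: "T (Poly_Mapping.single b c * Poly_Mapping.single d x ^ q)
      = T (Poly_Mapping.single b c) * Poly_Mapping.single d x" for b c d x
  proof (cases "b \<in> range s")
    case True
    then obtain b' where b: "b = s b'" by blast
    have "b + smult_exp q d = s (b' + d)" by (simp add: b s_def smult_exp_add add.assoc)
    then show ?thesis
      using T_single[of b' c] T_single[of "b' + d" "c * x ^ q"]
      by (simp add: single_power mult_single \<phi>4 flip: b)
  next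
    case False
    \<comment> \<open>Adding a multiple of \<open>q\<close> preserves residues, so both sides vanish
      outside the class of \<open>a\<close>.\<close>
    have "b + smult_exp q d \<notin> range s"
    proof
      assume "b + smult_exp q d \<in> range s"
      then obtain b' where "b + smult_exp q d = s b'" by blast
      then have *: "Poly_Mapping.lookup b i + q * Poly_Mapping.lookup d i
          = Poly_Mapping.lookup a i mod q + q * Poly_Mapping.lookup b' i" for i
        by (metis lookup_add lookup_s lookup_smult_exp)
      have modeq: "Poly_Mapping.lookup b i mod q = Poly_Mapping.lookup a i mod q" for i
        using arg_cong[OF *[of i], of "\<lambda>t. t mod q"] by simp
      then have "b = s (Abs_poly_mapping (\<lambda>i. Poly_Mapping.lookup b i div q))"
        by (intro poly_mapping_eqI) (simp add: lookup_s flip: modeq)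
      with False show False by blast
    qed
    with False show ?thesis by (simp add: single_power mult_single T_single_0)
  qed
  have T_mult: "T (g * h ^ q) = T g * h" for g h
  proof (induction g rule: poly_mapping_single_induct)
    case (single b c)
    show ?case
      by (induction h rule: poly_mapping_single_induct)
        (simp_all add: T_mult_single frob_add_mpoly distrib_left T_add)
  next
    case (add f g)
    then show ?case by (simp add: distrib_right T_add)
  qed
  \<comment> \<open>Quantifying over all multipliers \<open>g\<close> makes the right-hand side an
    ideal, so it suffices that it contains the generators \<open>f ^ q\<close>.\<close>
  have "bracket_pow q L \<subseteq> {f. \<forall>g. T (g * f) \<in> L}"
    unfolding bracket_pow_def
  proof (rule ideal_gen_minimal)
    show "{f ^ q | f. f \<in> L} \<subseteq> {f. \<forall>g. T (g * f) \<in> L}"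
      using ideal_times[OF L] by (auto simp: T_mult)
    have "T 0 = 0" by (rule poly_mapping_eqI) (simp add: lookup_T \<phi>0)
    then show "is_ideal {f. \<forall>g. T (g * f) \<in> L}"
      unfolding module.subspace_def[OF module_times]
      by (auto simp: ideal_zero[OF L] distrib_left T_add ideal_plus[OF L] simp flip: mult.assoc)
  qed
  with a have "T (1 * monomial a) \<in> L" by blast
  moreover have "a = s (Abs_poly_mapping (\<lambda>i. Poly_Mapping.lookup a i div q))"
    by (rule poly_mapping_eqI) (simp add: lookup_s)
  ultimately show ?thesis
    using T_single[of "Abs_poly_mapping (\<lambda>i. Poly_Mapping.lookup a i div q)" 1] \<phi>(1)
    by (simp add: monomial_def)
qed

end

text \<open>The inequality \<open>q * (x div q) \<le> x\<close> shows that the candidate qualifies.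
  Its minimality is tested against arbitrary ideals, including non-monomial ones, by means of the
  trace.\<close>

lemma bracket_root_monomial_span:
  fixes X :: "('n::finite \<Rightarrow> nat) set"
  assumes "prime p" "CHAR('k::field) = p" and q: "q = p ^ e" and X: "up_closed X"
  shows "bracket_root q (monomial_span X :: ('n, 'k) mpoly set) = monomial_span (up_div q X)"
  unfolding bracket_root_def
proof (rule Least_equality)
  have "is_ideal (monomial_span (up_div q X) :: ('n, 'k) mpoly set)"
    by (rule is_ideal_monomial_span) simp
  moreover have "X \<subseteq> up_scale q (up_div q X)"
  proof
    fix x assume "x \<in> X"
    then have "(\<lambda>i. x i div q) \<in> up_div q X" by (auto intro: up_divI)
    then show "x \<in> up_scale q (up_div q X)" by (rule up_scaleI) simp
  qed
  then have "(monomial_span X :: ('n, 'k) mpoly set) \<subseteq> monomial_span (up_scale q (up_div q X))"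
    by (auto simp: monomial_span_def)
  ultimately show "is_ideal (monomial_span (up_div q X) :: ('n, 'k) mpoly set)
      \<and> (monomial_span X :: ('n, 'k) mpoly set) \<subseteq> bracket_pow q (monomial_span (up_div q X))"
    using bracket_pow_monomial_span[OF assms(1-3), of "up_div q X"] by simp
next
  fix L :: "('n, 'k) mpoly set"
  assume L: "is_ideal L \<and> monomial_span X \<subseteq> bracket_pow q L"
  show "monomial_span (up_div q X) \<subseteq> L"
  proof (rule monomial_span_subset)
    show "is_ideal L" using L by blast
    fix a assume "Poly_Mapping.lookup a \<in> up_div q X"
    then obtain x where x: "x \<in> X" "\<And>i. x i div q \<le> Poly_Mapping.lookup a i"
      by (rule up_divE) blast
    have "(monomial (Abs_poly_mapping x) :: ('n, 'k) mpoly) \<in> monomial_span X"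
      using x(1) by simp
    then have "monomial (Abs_poly_mapping x) \<in> bracket_pow q L" using L by blast
    then have "monomial (Abs_poly_mapping (\<lambda>i. Poly_Mapping.lookup (Abs_poly_mapping x) i div q)) \<in> L"
      using monomial_div_in_ideal[OF assms(1-3)] L by blast
    then show "monomial a \<in> L"
      by (rule ideal_monomial_mono[OF \<open>is_ideal L\<close>]) (simp add: x(2))
  qed
qed

section \<open>From digits to Frobenius powers with real exponent\<close>

lemma up_closed_foldr_up_add: "up_closed (foldr up_add Xs UNIV)"
  by (cases Xs) simp_all

lemma up_scale_foldr_up_add:
  "up_scale q (foldr up_add Xs UNIV) = foldr up_add (map (up_scale q) Xs) UNIV"
  by (induction Xs) (simp_all add: up_scale_up_add)

text \<open>Splitting off the lowest digit leaves the digits of \<open>k div p\<close>, with one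
  more scaling by \<open>p\<close>: the digit product is evaluated by Horner's scheme. The bound
  says that \<open>n\<close> digits suffice.\<close>

lemma (in frob_exponents) foldr_digits_eq_G:
  "k < p ^ n \<Longrightarrow>
    foldr up_add (map (\<lambda>i. up_scale (p ^ i) (up_pow U (k div p ^ i mod p))) [0..<n]) UNIV = G k"
proof (induction n arbitrary: k)
  case (Suc n)
  have "k div p < p ^ n" using Suc.prems p2 by (simp add: less_mult_imp_div_less mult.commute)
  then have "G (k div p)
      = foldr up_add (map (\<lambda>i. up_scale (p ^ i) (up_pow U (k div p div p ^ i mod p))) [0..<n]) UNIV"
    by (rule Suc.IH[symmetric])
  then have "up_scale p (G (k div p)) = foldr up_add
      (map (\<lambda>i. up_scale (p ^ Suc i) (up_pow U (k div p ^ Suc i mod p))) [0..<n]) UNIV"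
    by (simp add: up_scale_foldr_up_add o_def up_scale_up_scale div_mult2_eq)
  moreover have "[0..<Suc n] = 0 # map Suc [0..<n]"
    by (simp only: map_Suc_upt) (simp add: upt_conv_Cons)
  ultimately show ?case
    by (subst G_rec) (simp add: o_def)
qed simp

locale monomial_frob = frob_exponents p U D
  for p :: nat and U :: "('n::finite \<Rightarrow> nat) set" and D :: nat +
  fixes I :: "('n, 'k::field) mpoly set"
  assumes prime: "prime p" and CHAR: "CHAR('k) = p" and I: "I = monomial_span U"
begin

lemma frob_pow_nat_eq: "frob_pow_nat p I k = monomial_span (G k)"
proof -
  have "foldr ideal_mult (map (\<lambda>i. bracket_pow (p ^ i) (ideal_pow I (k div p ^ i mod p))) xs) UNIV
      = monomial_span
          (foldr up_add (map (\<lambda>i. up_scale (p ^ i) (up_pow U (k div p ^ i mod p))) xs) UNIV)" for xs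
    by (induction xs)
      (simp_all add: I ideal_pow_monomial_span up_closed_U ideal_mult_monomial_span
        bracket_pow_monomial_span[OF prime CHAR refl] up_closed_foldr_up_add)
  \<comment> \<open>The range \<open>[0..<Suc k]\<close> therefore covers all nonzero
    digits.\<close>
  moreover have "k < p ^ Suc k"
    using less_exp[of "Suc k"] power_mono[OF p2, of "Suc k"] by linarith
  ultimately show ?thesis by (simp only: frob_pow_nat_def foldr_digits_eq_G)
qed

lemma frob_pow_frac_eq: "frob_pow_frac p I k e = monomial_span (W k e)"
  by (simp add: frob_pow_frac_def frob_pow_nat_eq W_def bracket_root_monomial_span[OF prime CHAR refl])

text \<open>Without such a sequence the description of \<open>frob_pow\<close> would hold vacuously
  for every ideal. The ceilings of \<open>l * p ^ j\<close> serve as numerators.\<close>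

lemma ex_decseq_frac_val:
  assumes "0 \<le> l"
  obtains k where "decseq (\<lambda>j. frac_val (k j) j)" "(\<lambda>j. frac_val (k j) j) \<longlonglongrightarrow> l"
proof
  define k where "k j = nat \<lceil>l * real (p ^ j)\<rceil>" for j
  have pos: "real (p ^ j) > 0" for j using p2 by simp
  have "0 \<le> l * real (p ^ j)" for j using assms by simp
  then have k: "l * real (p ^ j) \<le> real (k j)" "real (k j) \<le> l * real (p ^ j) + 1" for j
    unfolding k_def by (smt (verit) of_int_of_nat_eq nat_0_le ceiling_correct le_of_int_ceiling zero_le_ceiling)+
  show "decseq (\<lambda>j. frac_val (k j) j)"
    unfolding decseq_Suc_iff
  proof
    fix j
    have "l * real (p ^ Suc j) \<le> real (p * k j)"
      using mult_left_mono[OF k(1)[of j], of "real p"] by (simp add: ac_simps)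
    \<comment> \<open>\<open>p * k j\<close> is an integer not below \<open>l * p ^ Suc j\<close>,
      hence not below its ceiling.\<close>
    then have "k (Suc j) \<le> p * k j"
      unfolding k_def[of "Suc j"] by (simp add: nat_le_iff ceiling_le_iff)
    then have "real (k (Suc j)) \<le> real p * real (k j)" by (metis of_nat_le_iff of_nat_mult)
    then show "frac_val (k (Suc j)) (Suc j) \<le> frac_val (k j) j"
      using pos[of j] p2 by (simp add: field_simps)
  qed
  show "(\<lambda>j. frac_val (k j) j) \<longlonglongrightarrow> l"
  proof (rule tendsto_sandwich)
    show "\<forall>\<^sub>F j in sequentially. l \<le> frac_val (k j) j"
      using k(1) pos by (simp add: pos_le_divide_eq)
    have "frac_val (k j) j \<le> l + 1 / real p ^ j" for j
      using k(2)[of j] pos[of j] by (simp add: field_simps)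
    then show "\<forall>\<^sub>F j in sequentially. frac_val (k j) j \<le> l + 1 / real p ^ j" by simp
    have "(\<lambda>j. l + 1 / real p ^ j) \<longlonglongrightarrow> l + 0"
      using p2 by (intro tendsto_add tendsto_const LIMSEQ_divide_realpow_zero) simp
    then show "(\<lambda>j. l + 1 / real p ^ j) \<longlonglongrightarrow> l" by simp
  qed simp
qed

text \<open>A decreasing sequence with limit \<open>l\<close> never falls below \<open>l\<close> and
  eventually enters the interval on which \<open>W\<close> equals \<open>V l\<close>. Uniqueness
  follows by comparing along one existing sequence.\<close>

lemma frob_pow_eq:
  assumes "0 \<le> l"
  shows "frob_pow p I l = monomial_span (V l)"
  unfolding frob_pow_def
proof (rule the_equality)
  obtain c where c: "l < c" "\<And>k e. l \<le> frac_val k e \<Longrightarrow> frac_val k e < c \<Longrightarrow> W k e = V l"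
    using V_stable[OF assms] by blast
  have stable: "\<forall>\<^sub>F j in sequentially. frob_pow_frac p I (k j) (e j) = monomial_span (V l)"
    if dec: "decseq (\<lambda>j. frac_val (k j) (e j))"
      and lim: "(\<lambda>j. frac_val (k j) (e j)) \<longlonglongrightarrow> l" for k e :: "nat \<Rightarrow> nat"
  proof -
    have "l \<le> frac_val (k j) (e j)" for j using decseq_ge[OF dec lim] .
    moreover have "\<forall>\<^sub>F j in sequentially. frac_val (k j) (e j) < c"
      using order_tendstoD(2)[OF lim c(1)] .
    ultimately show ?thesis
      by (auto elim!: eventually_mono simp: frob_pow_frac_eq c(2))
  qed
  then show "\<forall>k e. decseq (\<lambda>j. frac_val (k j) (e j)) \<longrightarrow>
      (\<lambda>j. frac_val (k j) (e j)) \<longlonglongrightarrow> l \<longrightarrow>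
      (\<forall>\<^sub>F j in sequentially. frob_pow_frac p I (k j) (e j) = monomial_span (V l))"
    by blast
  fix J
  assume J: "\<forall>k e. decseq (\<lambda>j. frac_val (k j) (e j)) \<longrightarrow>
      (\<lambda>j. frac_val (k j) (e j)) \<longlonglongrightarrow> l \<longrightarrow>
      (\<forall>\<^sub>F j in sequentially. frob_pow_frac p I (k j) (e j) = J)"
  obtain k where k: "decseq (\<lambda>j. frac_val (k j) j)" "(\<lambda>j. frac_val (k j) j) \<longlonglongrightarrow> l"
    using ex_decseq_frac_val[OF assms] by blast
  have "\<forall>\<^sub>F j in sequentially. frob_pow_frac p I (k j) j = J"
    using J[rule_format, of k "\<lambda>j. j"] k by blast
  moreover have "\<forall>\<^sub>F j in sequentially. frob_pow_frac p I (k j) j = monomial_span (V l)"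
    using stable[of k "\<lambda>j. j"] k by blast
  ultimately have "\<forall>\<^sub>F j :: nat in sequentially. J = monomial_span (V l)"
    by eventually_elim simp
  then show "J = monomial_span (V l)" by simp
qed

text \<open>Equal exponent sets span equal ideals, so \<open>V m = V l\<close> with
  \<open>m < l\<close> contradicts criticality.\<close>

lemma critical_exponent_imp_jump:
  assumes "critical_exponent p I l"
  shows "jump l"
  using assms unfolding critical_exponent_def jump_def by (auto simp: frob_pow_eq)

end

theorem corollary3p9:
  fixes p :: nat
    and I :: "('n::finite, 'k::field) mpoly set"
    and A :: "('n \<Rightarrow>\<^sub>0 nat) set"
    and l :: real
  assumes "prime p"
    and "CHAR('k) = p"
    and "F_finite p TYPE('k)"
    and "finite A" and "A \<noteq> {}"
    and "I = ideal_gen (monomial ` A)"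
    and "I \<noteq> UNIV"
    and "critical_exponent p I l"
  shows "l \<in> \<rat>"
proof -
  define U where "U = {u. \<exists>a\<in>A. Poly_Mapping.lookup a \<le> u}"
  \<comment> \<open>The largest entry among the finitely many generators bounds the box of the
    locale.\<close>
  define D where "D = Max ((\<lambda>(a, i). Poly_Mapping.lookup a i) ` (A \<times> UNIV))"
  have D: "Poly_Mapping.lookup a i \<le> D" if "a \<in> A" for a i
    unfolding D_def by (rule Max_ge) (use that assms(4) in \<open>auto intro: image_eqI[of _ _ "(a, i)"]\<close>)
  interpret monomial_frob p U D I
  proof
    show "2 \<le> p" using assms(1) by (rule prime_ge_2_nat)
    show "up_closed U" by (auto simp: U_def up_closed_def intro: order_trans)
    show "U \<noteq> {}" using assms(5) by (auto simp: U_def)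
    show "\<exists>g\<in>U. g \<le> u \<and> (\<forall>i. g i \<le> D)" if "u \<in> U" for u
      using that D by (auto simp: U_def)
    show "I = monomial_span U" unfolding U_def assms(6) by (rule ideal_gen_monomials)
  qed (fact assms)+
  show ?thesis using assms(8) by (intro jump_rational critical_exponent_imp_jump)
qed

end
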